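(* Let $N\ge1$ be an integer and let $K_N$ be the $\mathrm{GUE}$ kernel. For every $\lambda_-\in\mathbb{R}$ and every $s\in\mathbb{C}$, the bilateral Laplace transform of $K_N(\lambda_++\lambda_-,\lambda_+-\lambda_-)$ with respect to the variable $\lambda_+$ is given by $$\int_{-\infty}^{\infty}e^{s\lambda_+}K_N(\lambda_++\lambda_-,\lambda_+-\lambda_-)\,\mathrm{d}\lambda_+=N\,e^{-\frac N2\lambda_-^2+\frac{s^2}{2N}}\;{}_1F_1\left(1-N;2\,\Big|\,N\lambda_-^2-\frac{s^2}{N}\right).$$
   Context: The Hermite polynomials are $h_k(x)=(-1)^ke^{N\frac{x^2}{2}}\frac{\mathrm{d}^k}{\mathrm{d}x^k}e^{-N\frac{x^2}{2}}$ and the normalized ones are $\tilde h_k(x)=\left[k!\,N^k\sqrt{\frac{2\pi}{N}}\right]^{-1/2}h_k(x)$, so that $\int_{-\infty}^\infty e^{-\frac{Nx^2}{2}}\tilde h_k(x)\tilde h_l(x)\,\mathrm{d}x=\delta_{k,l}$. The GUE kernel is $$K_N(x,y)=e^{-\frac N4(x^2+y^2)}\,\frac{\tilde h_N(x)\tilde h_{N-1}(y)-\tilde h_{N-1}(x)\tilde h_N(y)}{x-y},$$ extended by continuity to $x=y$. The confluent hypergeometric function is $${}_1F_1(a;c\,|\,x)=\sum_{k=0}^\infty\frac{a(a+1)\cdots(a+k-1)}{c(c+1)\cdots(c+k-1)\,k!}x^k .$$ *)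

theory Defs
  imports "HOL-Analysis.Analysis"
begin

definition hermite_fun :: "nat \<Rightarrow> nat \<Rightarrow> real \<Rightarrow> real" where
  "hermite_fun N k x =
     (-1) ^ k * exp (real N * x\<^sup>2 / 2) * (deriv ^^ k) (\<lambda>t. exp (- real N * t\<^sup>2 / 2)) x"

definition normalized_hermite :: "nat \<Rightarrow> nat \<Rightarrow> real \<Rightarrow> real" where
  "normalized_hermite N k x =
     (fact k * real N ^ k * sqrt (2 * pi / real N)) powr (- 1 / 2) * hermite_fun N k x"

definition gue_kernel_quot :: "nat \<Rightarrow> real \<Rightarrow> real \<Rightarrow> real" where
  "gue_kernel_quot N x y =
     exp (- real N / 4 * (x\<^sup>2 + y\<^sup>2)) *
     ((normalized_hermite N N x * normalized_hermite N (N - 1) y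
       - normalized_hermite N (N - 1) x * normalized_hermite N N y) / (x - y))"

text \<open>On the diagonal the value is the joint limit of the quotient along off-diagonal points,
  i.e. the continuous extension of the quotient to the plane.\<close>

definition gue_kernel :: "nat \<Rightarrow> real \<Rightarrow> real \<Rightarrow> real" where
  "gue_kernel N x y =
     (if x \<noteq> y then gue_kernel_quot N x y
      else Lim (at (x, y) within {(u, v). u \<noteq> v}) (\<lambda>(u, v). gue_kernel_quot N u v))"

definition hypergeo_1F1 :: "complex \<Rightarrow> complex \<Rightarrow> complex \<Rightarrow> complex" where
  "hypergeo_1F1 a c x = (\<Sum>k. pochhammer a k / (pochhammer c k * fact k) * x ^ k)"

end

theory Submission
  imports Defs "HOL-Probability.Probability"
begin

text \<open>By the Christoffel--Darboux identity the kernel is a Gaussian times a sum of products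
  \<open>h_k(x) h_k(y) / (k! N^k)\<close>. With \<open>x = u + a\<close> and \<open>y = u - a\<close>, integration by parts against
  \<open>exp (s u - N u^2 / 2)\<close> gives a recurrence for the integrals of \<open>h_j(u + a) h_l(u - a)\<close>.
  On the diagonal \<open>j = l = k\<close> its solution is the Laguerre polynomial \<open>L_k\<close> at
  \<open>N a^2 - s^2 / N\<close> (up to \<open>k! N^k\<close> times the plain Gaussian integral), and the sum of \<open>L_k\<close> over \<open>k < N\<close> is the terminating confluent
  hypergeometric series.\<close>

section \<open>Hermite polynomials and the Christoffel-Darboux identity\<close>

text \<open>One more derivative of \<open>h_k(t) exp (- c t^2 / 2)\<close>, with the sign reversed,
  yields this recursion. Working in \<open>real poly\<close> turns the later integral recurrences
  into polynomial identities.\<close>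

fun hermite_poly :: "real \<Rightarrow> nat \<Rightarrow> real poly" where
  "hermite_poly c 0 = 1"
| "hermite_poly c (Suc k) = [:0, c:] * hermite_poly c k - pderiv (hermite_poly c k)"

text \<open>If \<open>h_k' = c k h_(k-1)\<close>, then
  \<open>c x h_k' - h_k'' = c k (c x h_(k-1) - h_(k-1)')\<close>, and the bracket is
  \<open>h_k\<close> by the recursion. For \<open>k = 0\<close> the factor \<open>real k\<close>
  makes the truncated index harmless.\<close>

lemma pderiv_hermite_poly:
  "pderiv (hermite_poly c k) = smult (c * real k) (hermite_poly c (k - 1))"
proof (induction k)
  case (Suc k)
  have "pderiv (hermite_poly c (Suc k))
      = smult c (hermite_poly c k) + ([:0, c:] * pderiv (hermite_poly c k) - pderiv (pderiv (hermite_poly c k)))"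
    by (simp add: pderiv_diff pderiv_mult pderiv_pCons pderiv_smult algebra_simps)
  also have "[:0, c:] * pderiv (hermite_poly c k) - pderiv (pderiv (hermite_poly c k))
      = smult (c * real k) (hermite_poly c k)"
    unfolding Suc.IH by (cases k) (simp_all add: pderiv_smult smult_diff_right)
  finally show ?case
    by (simp add: distrib_left smult_add_left)
qed simp

lemma hermite_fun_eq_poly: "hermite_fun N k x = poly (hermite_poly (real N) k) x"
proof -
  have "(deriv ^^ k) (\<lambda>t. exp (- real N * t\<^sup>2 / 2))
      = (\<lambda>t. (-1) ^ k * poly (hermite_poly (real N) k) t * exp (- real N * t\<^sup>2 / 2))"
  proof (induction k)
    case (Suc k)
    have "deriv (\<lambda>t. (-1) ^ k * poly (hermite_poly (real N) k) t * exp (- real N * t\<^sup>2 / 2)) t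
        = (-1) ^ Suc k * poly (hermite_poly (real N) (Suc k)) t * exp (- real N * t\<^sup>2 / 2)" for t
      by (rule DERIV_imp_deriv) (auto intro!: derivative_eq_intros simp: algebra_simps)
    then show ?case using Suc by simp
  qed simp
  then show ?thesis
    by (simp add: hermite_fun_def field_simps power_mult_distrib flip: exp_add power_add mult_2)
qed

text \<open>Telescoping: the three-term recurrence shows that the numerator at \<open>Suc n\<close>
  is \<open>c (n + 1)\<close> times the one at \<open>n\<close> plus
  \<open>c (x - y) h_(n+1)(x) h_(n+1)(y)\<close>.\<close>

lemma hermite_christoffel_darboux:
  assumes "c \<noteq> 0"
  shows "(x - y) * (\<Sum>k\<le>n. poly (hermite_poly c k) x * poly (hermite_poly c k) y / (fact k * c ^ k))
    = (poly (hermite_poly c (Suc n)) x * poly (hermite_poly c n) y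
        - poly (hermite_poly c n) x * poly (hermite_poly c (Suc n)) y) / (fact n * c ^ Suc n)"
proof (induction n)
  case 0
  then show ?case using assms by (simp add: field_simps)
next
  case (Suc n)
  have rec: "poly (hermite_poly c (Suc (Suc n))) t
      = c * t * poly (hermite_poly c (Suc n)) t - c * real (Suc n) * poly (hermite_poly c n) t" for t
    by (subst hermite_poly.simps(2)) (simp add: pderiv_hermite_poly del: hermite_poly.simps)
  have "(x - y) * (\<Sum>k\<le>Suc n. poly (hermite_poly c k) x * poly (hermite_poly c k) y / (fact k * c ^ k))
      = (poly (hermite_poly c (Suc n)) x * poly (hermite_poly c n) y
        - poly (hermite_poly c n) x * poly (hermite_poly c (Suc n)) y) / (fact n * c ^ Suc n)
      + (x - y) * poly (hermite_poly c (Suc n)) x * poly (hermite_poly c (Suc n)) y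
          / (fact (Suc n) * c ^ Suc n)"
    using Suc.IH by (simp add: distrib_left del: hermite_poly.simps)
  also have "\<dots> = (poly (hermite_poly c (Suc (Suc n))) x * poly (hermite_poly c (Suc n)) y
        - poly (hermite_poly c (Suc n)) x * poly (hermite_poly c (Suc (Suc n))) y)
          / (fact (Suc n) * c ^ Suc (Suc n))"
    unfolding rec using assms by (simp add: field_simps del: hermite_poly.simps of_nat_Suc)
  finally show ?case .
qed

section \<open>The kernel as a finite sum, also on the diagonal\<close>

text \<open>This is the weighted sum of the products of normalized Hermite polynomials of degree
  below \<open>N\<close>; no division by \<open>x - y\<close> occurs, so it is continuous on the
  whole plane.\<close>

definition gue_sum :: "nat \<Rightarrow> real \<Rightarrow> real \<Rightarrow> real" where
  "gue_sum N x y = exp (- real N / 4 * (x\<^sup>2 + y\<^sup>2)) / sqrt (2 * pi / real N)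
     * (\<Sum>k<N. poly (hermite_poly (real N) k) x * poly (hermite_poly (real N) k) y
          / (fact k * real N ^ k))"

lemma gue_kernel_quot_eq_gue_sum:
  assumes "N \<ge> 1" "x \<noteq> y"
  shows "gue_kernel_quot N x y = gue_sum N x y"
proof -
  obtain n where N: "N = Suc n" using assms by (cases N) auto
  define c where "c = real N"
  have c: "c > 0" using N by (simp add: c_def)
  define r where "r = sqrt (2 * pi / c)"
  have r: "r > 0" "r * r = 2 * pi / c" using c by (simp_all add: r_def)
  define A where "A = fact N * c ^ N * r"
  define B where "B = fact n * c ^ n * r"
  have AB: "A > 0" "B > 0" using c r by (simp_all add: A_def B_def)
  \<comment> \<open>The product is a perfect square because the degree \<open>N\<close> equals the
    parameter \<open>c\<close>, so \<open>fact N = c * fact n\<close>. Its root is the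
    Christoffel-Darboux denominator times \<open>r\<close>.\<close>
  have "A * B = (fact n * c ^ Suc n * r)\<^sup>2"
    by (simp add: A_def B_def N c_def power2_eq_square algebra_simps)
  then have "A powr (-1/2) * B powr (-1/2) = ((fact n * c ^ Suc n * r)\<^sup>2) powr (-1/2)"
    using AB by (simp flip: powr_mult)
  also have "\<dots> = 1 / (fact n * c ^ Suc n * r)"
    using c r by (simp add: powr_minus_divide powr_half_sqrt)
  finally have norm: "A powr (-1/2) * B powr (-1/2) = 1 / (fact n * c ^ Suc n * r)" .
  let ?h = "\<lambda>k. poly (hermite_poly c k)"
  have "gue_kernel_quot N x y = exp (- c / 4 * (x\<^sup>2 + y\<^sup>2)) *
     ((A powr (-1/2) * B powr (-1/2)) * (?h N x * ?h n y - ?h n x * ?h N y) / (x - y))"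
    unfolding gue_kernel_quot_def normalized_hermite_def hermite_fun_eq_poly A_def B_def r_def c_def N
    by (simp add: algebra_simps del: hermite_poly.simps of_nat_Suc fact_Suc)
  also have "\<dots> = exp (- c / 4 * (x\<^sup>2 + y\<^sup>2)) / r *
     ((?h (Suc n) x * ?h n y - ?h n x * ?h (Suc n) y) / (fact n * c ^ Suc n) / (x - y))"
    unfolding norm N by (simp del: hermite_poly.simps of_nat_Suc fact_Suc)
  also have "\<dots> = gue_sum N x y"
    unfolding hermite_christoffel_darboux[OF less_imp_neq[OF c, symmetric], symmetric]
    using assms(2) by (simp add: gue_sum_def N r_def c_def lessThan_Suc_atMost del: of_nat_Suc)
  finally show ?thesis .
qed

text \<open>On the diagonal the limit defining the kernel is that of a continuous function agreeing
  with the quotient at all off-diagonal points.\<close>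

lemma gue_kernel_eq_gue_sum:
  assumes "N \<ge> 1"
  shows "gue_kernel N x y = gue_sum N x y"
proof (cases "x = y")
  case True
  let ?S = "{(u, v). u \<noteq> v} :: (real \<times> real) set"
  \<comment> \<open>\<open>Lim\<close> is determined only along a nontrivial filter, so diagonal
    points must be limits of off-diagonal ones.\<close>
  have "(x, x) islimpt ?S"
    unfolding islimpt_approachable
  proof safe
    fix e :: real assume "e > 0"
    then show "\<exists>z\<in>?S. z \<noteq> (x, x) \<and> dist z (x, x) < e"
      by (intro bexI[of _ "(x + e / 2, x)"]) (auto simp: dist_Pair_Pair dist_real_def)
  qed
  then have nb: "at (x, x) within ?S \<noteq> bot"
    by (simp add: trivial_limit_within)
  have "continuous_on UNIV (\<lambda>z. gue_sum N (fst z) (snd z))"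
    unfolding gue_sum_def by (intro continuous_intros) (use assms in auto)
  then have "isCont (\<lambda>z. gue_sum N (fst z) (snd z)) (x, x)"
    by (simp add: continuous_on_eq_continuous_at)
  then have "((\<lambda>z. gue_sum N (fst z) (snd z)) \<longlongrightarrow> gue_sum N x x) (at (x, x) within ?S)"
    unfolding isCont_def fst_conv snd_conv by (rule Lim_at_imp_Lim_at_within)
  then have "((\<lambda>(u, v). gue_kernel_quot N u v) \<longlongrightarrow> gue_sum N x x) (at (x, x) within ?S)"
    by (rule Lim_transform_eventually)
       (auto simp: eventually_at_filter gue_kernel_quot_eq_gue_sum[OF assms] intro!: always_eventually)
  then show ?thesis
    using True tendsto_Lim[OF nb] by (simp add: gue_kernel_def)
qed (simp add: gue_kernel_def gue_kernel_quot_eq_gue_sum[OF assms])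

section \<open>Decay and integrability against a Gaussian weight\<close>

lemma tendsto_poly_gaussian_at_top:
  fixes p :: "real poly"
  assumes "c > 0"
  shows "((\<lambda>u. poly p u * exp (a * u - c * u\<^sup>2 / 2)) \<longlongrightarrow> 0) at_top"
proof -
  have "((\<lambda>u. u ^ k * exp (a * u - c * u\<^sup>2 / 2)) \<longlongrightarrow> 0) at_top" for k
  proof (rule Lim_null_comparison[OF _ tendsto_power_div_exp_0[of k]])
    \<comment> \<open>Beyond this threshold the quadratic term dominates and the exponent is at most
      \<open>- u\<close>.\<close>
    have "eventually (\<lambda>u. u \<ge> max 0 (2 * (a + 1) / c)) at_top"
      by (rule eventually_ge_at_top)
    then show "\<forall>\<^sub>F u in at_top. norm (u ^ k * exp (a * u - c * u\<^sup>2 / 2)) \<le> u ^ k / exp u"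
    proof eventually_elim
      case (elim u)
      then have "2 * (a + 1) \<le> c * u" "u \<ge> 0"
        using assms by (simp_all add: field_simps)
      then have "2 * (a + 1) * u \<le> c * u * u" by (intro mult_right_mono)
      then have "a * u - c * u\<^sup>2 / 2 \<le> - u"
        by (simp add: power2_eq_square algebra_simps)
      then have "exp (a * u - c * u\<^sup>2 / 2) \<le> exp (- u)" by simp
      then have "u ^ k * exp (a * u - c * u\<^sup>2 / 2) \<le> u ^ k * exp (- u)"
        using \<open>u \<ge> 0\<close> by (intro mult_left_mono) auto
      moreover have "norm (u ^ k * exp (a * u - c * u\<^sup>2 / 2)) = u ^ k * exp (a * u - c * u\<^sup>2 / 2)"
        using \<open>u \<ge> 0\<close> by simp
      ultimately show ?case by (simp only: exp_minus divide_inverse)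
    qed
  qed
  then have "((\<lambda>u. \<Sum>i\<le>degree p. coeff p i * (u ^ i * exp (a * u - c * u\<^sup>2 / 2))) \<longlongrightarrow> 0) at_top"
    by (intro tendsto_null_sum tendsto_mult_right_zero)
  then show ?thesis by (simp add: poly_altdef sum_distrib_right mult.assoc)
qed

text \<open>With \<open>x = u + a\<close> and \<open>y = u - a\<close>, the kernel's Gaussian factor
  splits into \<open>exp (- c a^2 / 2)\<close> and \<open>exp (- c u^2 / 2)\<close>; the latter is
  merged here with the Laplace factor.\<close>

definition gaussian_weight :: "real \<Rightarrow> complex \<Rightarrow> real \<Rightarrow> complex" where
  "gaussian_weight c s u = exp (s * of_real u - of_real (c * u\<^sup>2 / 2))"

lemma norm_gaussian_weight: "norm (gaussian_weight c s u) = exp (Re s * u - c * u\<^sup>2 / 2)"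
  by (simp add: gaussian_weight_def)

lemma tendsto_poly_gaussian_weight:
  assumes "c > 0"
  shows "((\<lambda>u. of_real (poly p u) * gaussian_weight c s u) \<longlongrightarrow> 0) at_top"
    and "((\<lambda>u. of_real (poly p u) * gaussian_weight c s u) \<longlongrightarrow> 0) at_bot"
proof -
  have *: "((\<lambda>u. of_real (poly p u) * gaussian_weight c s u) \<longlongrightarrow> 0) at_top" for p s
    by (rule tendsto_norm_zero_cancel)
      (use tendsto_rabs_zero[OF tendsto_poly_gaussian_at_top[OF assms, of p "Re s"]]
        in \<open>simp add: norm_mult norm_gaussian_weight abs_mult\<close>)
  show "((\<lambda>u. of_real (poly p u) * gaussian_weight c s u) \<longlongrightarrow> 0) at_top" by (rule *)
  \<comment> \<open>Reflection \<open>u -> - u\<close> keeps the class of functions, replacing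
    \<open>s\<close> by \<open>- s\<close>, and exchanges the two ends.\<close>
  have "((\<lambda>u. of_real (poly p (- u)) * gaussian_weight c s (- u)) \<longlongrightarrow> 0) at_top"
    using *[of "pcompose p [:0, -1:]" "- s"] by (simp add: poly_pcompose gaussian_weight_def)
  then show "((\<lambda>u. of_real (poly p u) * gaussian_weight c s u) \<longlongrightarrow> 0) at_bot"
    by (simp add: filterlim_at_bot_mirror)
qed

text \<open>Completing the square makes the norm of the weight a multiple of the normal density with
  mean \<open>Re s / c\<close> and variance \<open>1 / c\<close>; expanding \<open>p\<close> about
  the mean leaves central moments.\<close>

lemma integrable_poly_gaussian_weight:
  assumes "c > 0"
  shows "integrable lborel (\<lambda>u. of_real (poly p u) * gaussian_weight c s u)"
proof -
  define \<mu> where "\<mu> = Re s / c"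
  define \<sigma> where "\<sigma> = 1 / sqrt c"
  define q where "q = pcompose p [:\<mu>, 1:]"
  define C where "C = sqrt (2 * pi * \<sigma>\<^sup>2) * exp (c * \<mu>\<^sup>2 / 2)"
  have \<sigma>: "\<sigma> > 0" "\<sigma>\<^sup>2 = 1 / c" using assms by (simp_all add: \<sigma>_def power_divide)
  have "integrable lborel (\<lambda>u. \<Sum>i\<le>degree q. coeff q i * (normal_density \<mu> \<sigma> u * (u - \<mu>) ^ i))"
    by (intro Bochner_Integration.integrable_sum integrable_mult_right integrable_normal_moment \<sigma>)
  also have "(\<lambda>u. \<Sum>i\<le>degree q. coeff q i * (normal_density \<mu> \<sigma> u * (u - \<mu>) ^ i))
      = (\<lambda>u. normal_density \<mu> \<sigma> u * poly p u)"
  proof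
    fix u
    have "poly p u = poly q (u - \<mu>)" by (simp add: q_def poly_pcompose)
    then show "(\<Sum>i\<le>degree q. coeff q i * (normal_density \<mu> \<sigma> u * (u - \<mu>) ^ i))
        = normal_density \<mu> \<sigma> u * poly p u"
      by (simp add: poly_altdef sum_distrib_left algebra_simps)
  qed
  finally have "integrable lborel (\<lambda>u. C * (normal_density \<mu> \<sigma> u * poly p u))"
    by (rule integrable_mult_right)
  then show ?thesis
  proof (rule Bochner_Integration.integrable_bound)
    show "(\<lambda>u. of_real (poly p u) * gaussian_weight c s u) \<in> borel_measurable lborel"
      unfolding gaussian_weight_def by (auto intro!: borel_measurable_continuous_onI continuous_intros)
    have "C * normal_density \<mu> \<sigma> u = exp (Re s * u - c * u\<^sup>2 / 2)" for u
    proof -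
      have "c * \<mu>\<^sup>2 / 2 - (u - \<mu>)\<^sup>2 / (2 * \<sigma>\<^sup>2) = Re s * u - c * u\<^sup>2 / 2"
        unfolding \<sigma>(2) using assms by (simp add: \<mu>_def field_simps power2_eq_square)
      then show ?thesis
        using \<sigma>(1) by (simp add: C_def normal_density_def flip: exp_add)
    qed
    then have "norm (of_real (poly p u) * gaussian_weight c s u)
        = norm (C * (normal_density \<mu> \<sigma> u * poly p u))" for u
      unfolding mult.assoc[symmetric] by (simp add: norm_mult norm_gaussian_weight abs_mult)
    then show "AE u in lborel. norm (of_real (poly p u) * gaussian_weight c s u)
        \<le> norm (C * (normal_density \<mu> \<sigma> u * poly p u))" by simp
  qed
qed

section \<open>The Gaussian integral as a linear functional on polynomials\<close>

definition gaussian_integral :: "real \<Rightarrow> complex \<Rightarrow> real poly \<Rightarrow> complex" where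
  "gaussian_integral c s p = (LBINT u. of_real (poly p u) * gaussian_weight c s u)"

lemma gaussian_integral_add:
  assumes "c > 0"
  shows "gaussian_integral c s (p + q) = gaussian_integral c s p + gaussian_integral c s q"
  unfolding gaussian_integral_def poly_add of_real_add distrib_right
  by (intro Bochner_Integration.integral_add integrable_poly_gaussian_weight assms)

lemma gaussian_integral_diff:
  assumes "c > 0"
  shows "gaussian_integral c s (p - q) = gaussian_integral c s p - gaussian_integral c s q"
  unfolding gaussian_integral_def poly_diff of_real_diff left_diff_distrib
  by (intro Bochner_Integration.integral_diff integrable_poly_gaussian_weight assms)

lemma gaussian_integral_smult:
  "gaussian_integral c s (smult b p) = of_real b * gaussian_integral c s p"
  by (simp add: gaussian_integral_def mult.assoc)

text \<open>The weight \<open>w\<close> satisfies \<open>w' = (s - c u) w\<close>, so this is the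
  integral of \<open>(p w)'\<close>, whose boundary values vanish.\<close>

lemma gaussian_integral_by_parts:
  assumes "c > 0"
  shows "gaussian_integral c s ([:0, c:] * p) = gaussian_integral c s (pderiv p) + s * gaussian_integral c s p"
proof -
  let ?F = "\<lambda>u. of_real (poly p u) * gaussian_weight c s u"
  let ?f = "\<lambda>u. of_real (poly (pderiv p) u) * gaussian_weight c s u + s * ?F u
      - of_real (poly ([:0, c:] * p) u) * gaussian_weight c s u"
  have int: "integrable lborel ?f"
    using assms by (intro Bochner_Integration.integrable_diff Bochner_Integration.integrable_add
        integrable_mult_right integrable_poly_gaussian_weight)
  have "(LBINT u=-\<infinity>..\<infinity>. ?f u) = 0 - 0"
  proof (rule interval_integral_FTC_integrable)
    fix u :: real
    have "((\<lambda>u. of_real (poly p u)) has_vector_derivative (of_real (poly (pderiv p) u) :: complex)) (at u)"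
      by (rule has_vector_derivative_of_real) (simp add: poly_DERIV flip: has_real_derivative_iff_has_vector_derivative)
    moreover have "(gaussian_weight c s has_vector_derivative (s - of_real (c * u)) * gaussian_weight c s u) (at u)"
    proof -
      have "((\<lambda>z. exp (s * z - of_real c * z\<^sup>2 / 2)) has_field_derivative
          (s - of_real (c * u)) * gaussian_weight c s u) (at (of_real u))"
        by (auto intro!: derivative_eq_intros simp: gaussian_weight_def)
      from has_vector_derivative_real_field[OF this] show ?thesis
        by (simp add: gaussian_weight_def[abs_def])
    qed
    ultimately show "(?F has_vector_derivative ?f u) (at u)"
      by (rule has_vector_derivative_eq_rhs[OF has_vector_derivative_mult]) (simp add: algebra_simps)
    show "isCont ?f u"
      unfolding gaussian_weight_def by (intro continuous_intros) auto
  next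
    show "set_integrable lborel (einterval (-\<infinity>) \<infinity>) ?f"
      using int by (simp add: set_integrable_def)
    show "((?F \<circ> real_of_ereal) \<longlongrightarrow> 0) (at_right (-\<infinity>))" "((?F \<circ> real_of_ereal) \<longlongrightarrow> 0) (at_left \<infinity>)"
      using tendsto_poly_gaussian_weight[OF assms, of p s]
      by (simp_all add: ereal_tendsto_simps)
  qed simp
  then have "(LBINT u. ?f u) = 0"
    by (simp add: interval_lebesgue_integral_def set_lebesgue_integral_def)
  moreover have "(LBINT u. ?f u) = gaussian_integral c s (pderiv p) + s * gaussian_integral c s p
      - gaussian_integral c s ([:0, c:] * p)"
    unfolding gaussian_integral_def using assms
    by (simp add: integrable_poly_gaussian_weight del: mult_pCons_left poly_mult)
  ultimately show ?thesis by simp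
qed

text \<open>Centring at \<open>Re s / c\<close> and scaling by \<open>1 / sqrt c\<close> leaves the
  characteristic function of the standard normal law, evaluated at
  \<open>Im s / sqrt c\<close>.\<close>

lemma gaussian_integral_1:
  assumes "c > 0"
  shows "gaussian_integral c s 1 = of_real (sqrt (2 * pi / c)) * exp (s\<^sup>2 / (2 * of_real c))"
proof -
  define a b where "a = Re s" and "b = Im s"
  have s: "s = of_real a + \<i> * of_real b" by (simp add: a_def b_def complex_eq)
  define r where "r = sqrt c"
  have r: "r > 0" "c = r\<^sup>2" using assms by (simp_all add: r_def)
  \<comment> \<open>The part of the exponent free of \<open>v\<close> after the substitution;
    subtracting \<open>b^2 / (2 c)\<close> from it gives \<open>s^2 / (2 c)\<close>.\<close>
  define A where "A = of_real (a\<^sup>2 / (2 * c)) + \<i> * of_real (a * b / c)"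
  define K where "K = exp A * of_real (sqrt (2 * pi))"
  have "gaussian_integral c s 1 = of_real (1 / r) * (LBINT v. gaussian_weight c s (a / c + 1 / r * v))"
    unfolding gaussian_integral_def
    using r by (subst lborel_integral_real_affine[where c = "1 / r" and t = "a / c"]) (auto simp: scaleR_conv_of_real)
  also have "(LBINT v. gaussian_weight c s (a / c + 1 / r * v))
      = (LBINT v. K * (std_normal_density v *\<^sub>R iexp (b / r * v)))"
  proof (rule Bochner_Integration.integral_cong[OF refl])
    fix v
    have "s * of_real (a / c + 1 / r * v) - of_real (c * (a / c + 1 / r * v)\<^sup>2 / 2)
       = A + of_real (- v\<^sup>2 / 2) + \<i> * of_real (b / r * v)"
      unfolding s A_def using r(1) by (simp add: complex_eq_iff r(2) field_simps power2_eq_square)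
    then have "gaussian_weight c s (a / c + 1 / r * v)
        = exp A * exp (of_real (- v\<^sup>2 / 2)) * exp (\<i> * of_real (b / r * v))"
      unfolding gaussian_weight_def by (simp only: exp_add)
    then show "gaussian_weight c s (a / c + 1 / r * v) = K * (std_normal_density v *\<^sub>R iexp (b / r * v))"
      by (simp add: K_def std_normal_density_def scaleR_conv_of_real real_sqrt_mult flip: exp_of_real)
  qed
  also have "\<dots> = K * (LBINT v. std_normal_density v *\<^sub>R iexp (b / r * v))"
    by (rule integral_mult_right_zero)
  also have "(LBINT v. std_normal_density v *\<^sub>R iexp (b / r * v)) = char std_normal_distribution (b / r)"
    by (simp add: char_def integral_density)
  also have "K * char std_normal_distribution (b / r) = K * exp (of_real (- (b / r)\<^sup>2 / 2))"
    by (simp add: char_std_normal_distribution flip: exp_of_real)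
  also have "\<dots> = of_real (sqrt (2 * pi)) * (exp A * exp (of_real (- (b / r)\<^sup>2 / 2)))"
    by (simp add: K_def)
  also have "exp A * exp (of_real (- (b / r)\<^sup>2 / 2)) = exp (s\<^sup>2 / (2 * of_real c))"
  proof -
    have "A + of_real (- (b / r)\<^sup>2 / 2) = s\<^sup>2 / (2 * of_real c)"
      unfolding s A_def using r(1) by (simp add: r(2) field_simps power2_eq_square)
    then show ?thesis by (simp only: exp_add[symmetric])
  qed
  finally show ?thesis
    using r by (simp add: real_sqrt_divide)
qed

section \<open>Solution of the recurrence and its Laguerre diagonal\<close>

text \<open>Weighted count of partial matchings between a \<open>j\<close>-set and an
  \<open>l\<close>-set: \<open>c\<close> for each matched pair, \<open>p\<close> or \<open>q\<close>
  for each unmatched point. Terms with \<open>i > l\<close> vanish through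
  \<open>l choose i\<close>.\<close>

definition hermite_pairing :: "real \<Rightarrow> complex \<Rightarrow> complex \<Rightarrow> nat \<Rightarrow> nat \<Rightarrow> complex" where
  "hermite_pairing c p q j l = (\<Sum>i\<le>j. fact i * of_real c ^ i * of_nat (j choose i) * of_nat (l choose i)
      * p ^ (j - i) * q ^ (l - i))"

lemma hermite_pairing_0: "hermite_pairing c p q 0 l = q ^ l"
  by (simp add: hermite_pairing_def)

text \<open>The added point is either matched with one of \<open>l\<close> points or left unmatched.
  Algebraically this is Pascal's rule for \<open>Suc j\<close> plus the absorption identity for
  \<open>l choose Suc i\<close>.\<close>

lemma hermite_pairing_Suc:
  "hermite_pairing c p q (Suc j) l
    = of_real c * of_nat l * hermite_pairing c p q j (l - 1) + p * hermite_pairing c p q j l"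
proof -
  let ?t = "\<lambda>i. fact i * of_real c ^ i * of_nat (j choose i) * of_nat (l choose i)
      * p ^ (Suc j - i) * q ^ (l - i) :: complex"
  have 1: "fact (Suc i) * of_real c ^ Suc i * of_nat (Suc j choose Suc i) * of_nat (l choose Suc i)
      * p ^ (Suc j - Suc i) * q ^ (l - Suc i)
      = of_real c * of_nat l * (fact i * of_real c ^ i * of_nat (j choose i) * of_nat (l - 1 choose i)
          * p ^ (j - i) * q ^ (l - 1 - i)) + ?t (Suc i)" for i
  proof -
    have "of_nat (Suc i * (l choose Suc i)) = (of_nat (l * (l - 1 choose i)) :: complex)"
      by (subst times_binomial_minus1_eq) auto
    then have "fact (Suc i) * of_nat (l choose Suc i) = (fact i * (of_nat l * of_nat (l - 1 choose i)) :: complex)"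
      by (simp only: of_nat_mult fact_Suc) (simp only: mult_ac)
    then show ?thesis
      by (simp add: distrib_left distrib_right del: fact_Suc of_nat_Suc)
  qed
  have "hermite_pairing c p q (Suc j) l = ?t 0 + of_real c * of_nat l * hermite_pairing c p q j (l - 1)
      + (\<Sum>i\<le>j. ?t (Suc i))"
    unfolding hermite_pairing_def sum.atMost_Suc_shift 1 sum.distrib sum_distrib_left by simp
  also have "?t 0 + of_real c * of_nat l * hermite_pairing c p q j (l - 1) + (\<Sum>i\<le>j. ?t (Suc i))
      = of_real c * of_nat l * hermite_pairing c p q j (l - 1) + (\<Sum>i\<le>Suc j. ?t i)"
    unfolding sum.atMost_Suc_shift by simp
  \<comment> \<open>The top term vanishes because \<open>j choose Suc j = 0\<close>.\<close>
  also have "(\<Sum>i\<le>Suc j. ?t i) = (\<Sum>i\<le>j. ?t i)" by simp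
  also have "\<dots> = p * hermite_pairing c p q j l"
    unfolding hermite_pairing_def sum_distrib_left
    by (intro sum.cong) (auto simp: Suc_diff_le)
  finally show ?thesis .
qed

text \<open>Reversing the summation by \<open>i -> k - i\<close> exhibits the Laguerre polynomial
  \<open>L_k\<close> at \<open>- p q / c\<close>.\<close>

lemma hermite_pairing_diagonal:
  assumes "c \<noteq> 0"
  shows "hermite_pairing c p q k k / (fact k * of_real c ^ k)
    = (\<Sum>j\<le>k. of_nat (k choose j) / fact j * (p * q / of_real c) ^ j)"
proof -
  have "hermite_pairing c p q k k / (fact k * of_real c ^ k)
      = (\<Sum>i\<le>k. fact i * of_real c ^ i * of_nat (k choose i) * of_nat (k choose i)
      * p ^ (k - i) * q ^ (k - i) / (fact k * of_real c ^ k))"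
    unfolding hermite_pairing_def by (rule sum_divide_distrib)
  also have "\<dots> = (\<Sum>i\<le>k. of_nat (k choose (k - i)) / fact (k - i) * (p * q / of_real c) ^ (k - i))"
  proof (rule sum.cong[OF refl])
    fix i assume "i \<in> {..k}"
    then have i: "i \<le> k" by simp
    have *: "of_nat (k choose i) = (fact k / (fact i * fact (k - i)) :: complex)"
      by (rule binomial_fact[OF i])
    have c: "of_real c ^ k = (of_real c ^ i * of_real c ^ (k - i) :: complex)"
      using i by (simp flip: power_add)
    show "fact i * of_real c ^ i * of_nat (k choose i) * of_nat (k choose i)
      * p ^ (k - i) * q ^ (k - i) / (fact k * of_real c ^ k)
      = of_nat (k choose (k - i)) / fact (k - i) * (p * q / of_real c) ^ (k - i)"
      unfolding binomial_symmetric[OF i, symmetric] * c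
      using assms by (simp add: power_mult_distrib power_divide)
  qed
  also have "\<dots> = (\<Sum>j\<le>k. of_nat (k choose j) / fact j * (p * q / of_real c) ^ j)"
    by (rule sum.reindex_bij_witness[of _ "\<lambda>i. k - i" "\<lambda>i. k - i"]) auto
  finally show ?thesis .
qed

text \<open>Swapping the sums and applying the hockey-stick identity turns the coefficients into
  \<open>N choose (j + 1)\<close>, which match the hypergeometric ones term by term.\<close>

lemma hypergeo_1F1_eq_laguerre_sum:
  "(\<Sum>k<N. \<Sum>j\<le>k. of_nat (k choose j) / fact j * (- z) ^ j)
    = of_nat N * hypergeo_1F1 (1 - of_nat N) 2 z"
proof (cases N)
  case (Suc n)
  have term_eq: "of_nat (Suc n) * (pochhammer (- of_nat n) j / (pochhammer 2 j * fact j) * z ^ j)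
      = of_nat (Suc n choose Suc j) / fact j * (- z) ^ j" for j
  proof -
    \<comment> \<open>Both sides are the rising factorial of 1 of length
      \<open>Suc j\<close>.\<close>
    have "pochhammer (2::complex) j = fact (Suc j)"
      unfolding pochhammer_fact pochhammer_rec by simp
    moreover have "of_nat (Suc n choose Suc j) = (of_nat (Suc n) * of_nat (n choose j) / of_nat (Suc j) :: complex)"
      unfolding of_nat_mult[symmetric] Suc_times_binomial[symmetric] unfolding of_nat_mult
      by (simp del: of_nat_Suc binomial_Suc_Suc)
    moreover have "pochhammer (- of_nat n) j = (-1) ^ j * fact j * (of_nat (n choose j) :: complex)"
      by (simp add: binomial_gbinomial gbinomial_pochhammer flip: power_add)
    ultimately show ?thesis
      by (simp add: power_minus[of z] field_simps del: of_nat_Suc binomial_Suc_Suc)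
  qed
  have "(\<Sum>k<N. \<Sum>j\<le>k. of_nat (k choose j) / fact j * (- z) ^ j)
      = (\<Sum>k\<le>n. \<Sum>j\<le>n. of_nat (k choose j) / fact j * (- z) ^ j)"
    \<comment> \<open>The inner range can be extended to \<open>n\<close> since
      \<open>k choose j = 0\<close> for \<open>j > k\<close>; the sums then swap freely.\<close>
    unfolding Suc lessThan_Suc_atMost
    by (intro sum.cong sum.mono_neutral_left) auto
  also have "\<dots> = (\<Sum>j\<le>n. (\<Sum>k\<le>n. of_nat (k choose j)) / fact j * (- z) ^ j)"
    by (subst sum.swap) (simp add: sum_distrib_right sum_divide_distrib)
  also have "\<dots> = (\<Sum>j\<le>n. of_nat (Suc n) * (pochhammer (- of_nat n) j / (pochhammer 2 j * fact j) * z ^ j))"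
    unfolding term_eq of_nat_sum[symmetric] sum_choose_upper ..
  also have "\<dots> = of_nat (Suc n) * (\<Sum>j. pochhammer (- of_nat n) j / (pochhammer 2 j * fact j) * z ^ j)"
    unfolding sum_distrib_left[symmetric]
    \<comment> \<open>The series terminates: the rising factorial of \<open>- n\<close> contains the
      factor 0 once \<open>j > n\<close>.\<close>
    by (subst suminf_finite[of "{..n}"]) (auto simp: pochhammer_of_nat_eq_0_lemma)
  finally show ?thesis by (simp add: Suc hypergeo_1F1_def)
qed simp

section \<open>Integrals of products of shifted Hermite polynomials\<close>

lemma gaussian_integral_pcompose_hermite_poly_Suc:
  assumes "c > 0"
  shows "gaussian_integral c s (pcompose (hermite_poly c (Suc k)) [:b, 1:] * q)
    = (s + of_real (c * b)) * gaussian_integral c s (pcompose (hermite_poly c k) [:b, 1:] * q)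
      + gaussian_integral c s (pcompose (hermite_poly c k) [:b, 1:] * pderiv q)"
proof -
  define h where "h = pcompose (hermite_poly c k) [:b, 1:]"
  \<comment> \<open>The recursion's \<open>- h' q\<close> is written as
    \<open>- (h q)' + h q'\<close>, so that the derivative \<open>(h q)'\<close> produced by
    integrating \<open>c u h q\<close> by parts cancels.\<close>
  have "pcompose (hermite_poly c (Suc k)) [:b, 1:] * q
      = [:0, c:] * (h * q) + smult (c * b) (h * q) - pderiv (h * q) + h * pderiv q"
    by (simp add: h_def pcompose_diff pcompose_add pcompose_smult pcompose_pCons pderiv_pcompose pderiv_pCons
        pderiv_mult smult_add_right algebra_simps)
  then show ?thesis
    by (simp only: gaussian_integral_add gaussian_integral_diff gaussian_integral_smult
        gaussian_integral_by_parts assms) (simp add: h_def algebra_simps)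
qed

text \<open>Raising \<open>j\<close> differentiates the other factor, which gives \<open>c l\<close>
  times its predecessor: exactly the recurrence of \<open>hermite_pairing_Suc\<close>. Hence
  \<open>l\<close> must stay arbitrary in the induction.\<close>

lemma gaussian_integral_hermite_poly:
  assumes "c > 0"
  shows "gaussian_integral c s (pcompose (hermite_poly c j) [:a, 1:] * pcompose (hermite_poly c l) [:- a, 1:])
    = hermite_pairing c (s + of_real (c * a)) (s - of_real (c * a)) j l * gaussian_integral c s 1"
proof (induction j arbitrary: l)
  case 0
  show ?case
  proof (induction l)
    case (Suc l)
    then show ?case
      \<comment> \<open>With shift \<open>- a\<close> and cofactor 1 the derivative term disappears,
        leaving a factor \<open>s - c a\<close> per degree.\<close>
      using gaussian_integral_pcompose_hermite_poly_Suc[OF assms, of s l "- a" 1]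
      by (simp add: hermite_pairing_0 gaussian_integral_def pcompose_1 mult.assoc del: hermite_poly.simps(2))
  qed (simp add: hermite_pairing_0 pcompose_1)
next
  case (Suc j)
  have "pderiv (pcompose (hermite_poly c l) [:- a, 1:]) = smult (c * real l) (pcompose (hermite_poly c (l - 1)) [:- a, 1:])"
    by (simp add: pderiv_pcompose pderiv_hermite_poly pderiv_pCons pcompose_smult)
  then show ?case
    unfolding gaussian_integral_pcompose_hermite_poly_Suc[OF assms] hermite_pairing_Suc
    by (simp add: Suc.IH gaussian_integral_smult algebra_simps)
qed

section \<open>Assembly of the Laplace transform\<close>

theorem theorem2:
  fixes N :: nat and lm :: real and s :: complex
  assumes "N \<ge> 1"
  shows "has_bochner_integral lborel
           (\<lambda>lp::real. exp (s * of_real lp) * of_real (gue_kernel N (lp + lm) (lp - lm)))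
           (of_nat N * exp (of_real (- real N / 2 * lm\<^sup>2) + s\<^sup>2 / (2 * of_nat N))
              * hypergeo_1F1 (1 - of_nat N) 2 (of_real (real N * lm\<^sup>2) - s\<^sup>2 / of_nat N))"
proof -
  define c where "c = real N"
  have c: "c > 0" using assms by (simp add: c_def)
  define r where "r = sqrt (2 * pi / c)"
  have r: "r > 0" using c by (simp add: r_def)
  define E where "E = exp (- c / 2 * lm\<^sup>2)"
  define z where "z = of_real (c * lm\<^sup>2) - s\<^sup>2 / of_real c"
  define p where "p k = pcompose (hermite_poly c k) [:lm, 1:] * pcompose (hermite_poly c k) [:- lm, 1:]" for k
  have p: "gaussian_integral c s (p k) / (fact k * of_real c ^ k)
      = (\<Sum>j\<le>k. of_nat (k choose j) / fact j * (- z) ^ j) * gaussian_integral c s 1" for k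
  proof -
    \<comment> \<open>The product is \<open>s^2 - c^2 lm^2\<close>; this is where the hypergeometric
      argument comes from.\<close>
    have "(s + of_real (c * lm)) * (s - of_real (c * lm)) / of_real c = - z"
      using c by (simp add: z_def field_simps power2_eq_square)
    then show ?thesis
      using hermite_pairing_diagonal[of c "s + of_real (c * lm)" "s - of_real (c * lm)" k] c
      by (simp add: p_def gaussian_integral_hermite_poly flip: times_divide_eq_left)
  qed
  have "has_bochner_integral lborel
      (\<lambda>u. of_real (E / r) * (\<Sum>k<N. of_real (poly (p k) u) * gaussian_weight c s u / (fact k * of_real c ^ k)))
      (of_real (E / r) * (\<Sum>k<N. gaussian_integral c s (p k) / (fact k * of_real c ^ k)))"
    unfolding gaussian_integral_def
    by (intro has_bochner_integral_mult_right has_bochner_integral_sum has_bochner_integral_divide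
        has_bochner_integral_integrable integrable_poly_gaussian_weight c)
  also have "(\<lambda>u. of_real (E / r) * (\<Sum>k<N. of_real (poly (p k) u) * gaussian_weight c s u / (fact k * of_real c ^ k)))
      = (\<lambda>u. exp (s * of_real u) * of_real (gue_kernel N (u + lm) (u - lm)))"
  proof
    fix u
    have "- c / 4 * ((u + lm)\<^sup>2 + (u - lm)\<^sup>2) = - c / 2 * lm\<^sup>2 + - c * u\<^sup>2 / 2"
      by (simp add: power2_eq_square algebra_simps)
    then have *: "exp (- c / 4 * ((u + lm)\<^sup>2 + (u - lm)\<^sup>2)) = E * exp (- c * u\<^sup>2 / 2)"
      by (simp only: exp_add E_def)
    have "gaussian_weight c s u = exp (s * of_real u) * of_real (exp (- c * u\<^sup>2 / 2))"
      unfolding gaussian_weight_def exp_of_real[symmetric] exp_add[symmetric] by simp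
    then show "of_real (E / r) * (\<Sum>k<N. of_real (poly (p k) u) * gaussian_weight c s u / (fact k * of_real c ^ k))
        = exp (s * of_real u) * of_real (gue_kernel N (u + lm) (u - lm))"
      unfolding gue_kernel_eq_gue_sum[OF assms] gue_sum_def c_def[symmetric] r_def[symmetric] *
      by (simp add: p_def poly_pcompose sum_distrib_left algebra_simps)
  qed
  also have "of_real (E / r) * (\<Sum>k<N. gaussian_integral c s (p k) / (fact k * of_real c ^ k))
      = of_real (E / r) * gaussian_integral c s 1 * (of_nat N * hypergeo_1F1 (1 - of_nat N) 2 z)"
    unfolding p sum_distrib_right[symmetric] hypergeo_1F1_eq_laguerre_sum by simp
  \<comment> \<open>The normalization \<open>1 / r\<close> of the kernel cancels the factor
    \<open>r\<close> of the plain Gaussian integral.\<close>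
  also have "of_real (E / r) * gaussian_integral c s 1
      = exp (of_real (- real N / 2 * lm\<^sup>2) + s\<^sup>2 / (2 * of_nat N))"
    unfolding gaussian_integral_1[OF c] r_def[symmetric] exp_add using r
    by (simp add: E_def c_def flip: exp_of_real)
  also have "\<dots> * (of_nat N * hypergeo_1F1 (1 - of_nat N) 2 z)
      = of_nat N * exp (of_real (- real N / 2 * lm\<^sup>2) + s\<^sup>2 / (2 * of_nat N))
              * hypergeo_1F1 (1 - of_nat N) 2 (of_real (real N * lm\<^sup>2) - s\<^sup>2 / of_nat N)"
    by (simp add: z_def c_def)
  finally show ?thesis .
qed

end
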